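(* For every $n\ge1$, the six pairs of set-valued statistics $(\mathrm{Cyc_B},\mathrm{Rmil_B})$, $(\mathrm{Cyc_B},\mathrm{Lmap_B})$, $(\mathrm{Rmil_B},\mathrm{Lmap_B})$, $(\mathrm{Lmap_B},\mathrm{Rmil_B})$, $(\mathrm{Lmap_B},\mathrm{Cyc_B})$ and $(\mathrm{Rmil_B},\mathrm{Cyc_B})$ are equidistributed over $B_n$; that is, for any two subsets $X,Y\subseteq[n]$, the number of $\sigma\in B_n$ with $(S_1\sigma,S_2\sigma)=(X,Y)$ is the same for each of these six pairs $(S_1,S_2)$.
   Context: $B_n$: bijections $\sigma$ of $\{\pm1,\ldots,\pm n\}$ with $\sigma(-i)=-\sigma(i)$, written $\sigma_1\cdots\sigma_n$, $\sigma_i=\sigma(i)$. $\mathrm{Lmap_B}\,\sigma=\{i:\sigma_i>|\sigma_j|\text{ for all }j<i\}$. $\mathrm{Rmil_B}\,\sigma=\{\sigma_i:0<\sigma_i<|\sigma_j|\text{ for all }j>i\}$. $\mathrm{Cyc_B}\,\sigma$ is the set of minimal elements of those cycles $C$ of the permutation $i\mapsto|\sigma(i)|$ of $[n]$ for which the number of $i\in C$ with $\sigma(i)<0$ is even.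
   Formalization: Lmap_B is taken with the additional condition σ_i > 0 (the convention σ_0 = 0), which matters only for i = 1; without it 1 always lies in Lmap_B σ and the claim fails for n = 1, σ = −1. *)

theory Defs
  imports "HOL-Combinatorics.Combinatorics"
begin

abbreviation interval :: "nat \<Rightarrow> int set" where
  "interval n \<equiv> {1..int n}"

definition signed_interval :: "nat \<Rightarrow> int set" where
  "signed_interval n = interval n \<union> uminus ` interval n"

text \<open>
  Bijections of the signed interval are represented by functions on all integers that are the
  identity elsewhere, so that each signed permutation has exactly one representative.
\<close>

definition signed_perms :: "nat \<Rightarrow> (int \<Rightarrow> int) set" where
  "signed_perms n =
     {\<sigma>. \<sigma> permutes signed_interval n \<and> (\<forall>i\<in>signed_interval n. \<sigma> (- i) = - \<sigma> i)}"

text \<open>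
  The positivity requirement in \<open>LmapB\<close> amounts to the usual convention \<open>\<sigma> 0 = 0\<close> with the comparison
  also ranging over \<open>j = 0\<close>.  It only matters for \<open>i = 1\<close>, where the comparison with the positive
  positions \<open>j < i\<close> is vacuous: position 1 counts as a left-to-right maximum only if \<open>\<sigma> 1 > 0\<close>.
  Otherwise equidistribution already fails for \<open>n = 1\<close> and \<open>\<sigma> 1 = -1\<close>.
\<close>

definition LmapB :: "nat \<Rightarrow> (int \<Rightarrow> int) \<Rightarrow> int set" where
  "LmapB n \<sigma> =
     {i \<in> interval n. 0 < \<sigma> i \<and> (\<forall>j\<in>interval n. j < i \<longrightarrow> \<bar>\<sigma> j\<bar> < \<sigma> i)}"

definition RmilB :: "nat \<Rightarrow> (int \<Rightarrow> int) \<Rightarrow> int set" where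
  "RmilB n \<sigma> =
     {\<sigma> i | i. i \<in> interval n \<and> 0 < \<sigma> i \<and> (\<forall>j\<in>interval n. i < j \<longrightarrow> \<sigma> i < \<bar>\<sigma> j\<bar>)}"

definition abs_cycles :: "nat \<Rightarrow> (int \<Rightarrow> int) \<Rightarrow> int set set" where
  "abs_cycles n \<sigma> = {orbit (\<lambda>i. \<bar>\<sigma> i\<bar>) k | k. k \<in> interval n}"

definition CycB :: "nat \<Rightarrow> (int \<Rightarrow> int) \<Rightarrow> int set" where
  "CycB n \<sigma> = {Min C | C. C \<in> abs_cycles n \<sigma> \<and> even (card {i \<in> C. \<sigma> i < 0})}"

definition joint_count ::
  "nat \<Rightarrow> (nat \<Rightarrow> (int \<Rightarrow> int) \<Rightarrow> int set) \<Rightarrow> (nat \<Rightarrow> (int \<Rightarrow> int) \<Rightarrow> int set)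
     \<Rightarrow> int set \<Rightarrow> int set \<Rightarrow> nat" where
  "joint_count n S T X Y = card {\<sigma> \<in> signed_perms n. (S n \<sigma>, T n \<sigma>) = (X, Y)}"

end

theory Submission
  imports Defs
begin

text \<open>
  Passing to the inverse exchanges \<^const>\<open>LmapB\<close> and \<^const>\<open>RmilB\<close> and preserves \<^const>\<open>CycB\<close>, so all six
  pairs are linked once \<open>(CycB, RmilB)\<close> and \<open>(LmapB, RmilB)\<close> are known to be equidistributed.  Each signed
  permutation of \<open>1, \<dots>, N\<close> factors uniquely as \<open>\<rho>\<^sub>v \<circ> \<sigma>\<close>, where \<open>\<sigma>\<close> fixes \<open>N\<close>, \<open>v\<close> is the last letter
  and \<open>\<rho>\<^sub>v\<close> is any chosen signed permutation with \<open>\<rho>\<^sub>v N = v\<close>.  If moreover \<open>\<rho>\<^sub>v\<close> fixes all \<open>x\<close> with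
  \<open>\<bar>x\<bar> < \<bar>v\<bar>\<close>, then \<open>RmilB\<close> loses its elements from \<open>\<bar>v\<bar>\<close> on and gains \<open>v\<close> if \<open>v > 0\<close>.  For \<open>\<rho>\<^sub>v\<close> the
  signed transposition of \<open>N\<close> and \<open>v\<close>, \<open>CycB\<close> gains \<open>N\<close> exactly if \<open>v = N\<close>; for \<open>\<rho>\<^sub>v\<close> the signed cycle
  that raises the absolute values from \<open>\<bar>v\<bar>\<close> on, the same holds for \<open>LmapB\<close>.  Both pairs thus obey the
  same recursion.
\<close>

section \<open>Signed permutations\<close>

lemma mem_signed_interval: "x \<in> signed_interval n \<longleftrightarrow> x \<noteq> 0 \<and> \<bar>x\<bar> \<le> int n"
  by (cases "x < 0") (force simp: signed_interval_def image_iff)+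

lemma finite_signed_interval: "finite (signed_interval n)"
  by (simp add: signed_interval_def)

text \<open>Oddness extends to all of \<open>int\<close>, because a domain closed under negation is
  extended by the identity. In this form later proofs need fewer membership side conditions;
  \<open>0\<close> is fixed since oddness gives \<open>\<sigma> 0 = - \<sigma> 0\<close>.\<close>

lemma signed_perms_iff:
  "\<sigma> \<in> signed_perms n \<longleftrightarrow> bij \<sigma> \<and> (\<forall>x. \<sigma> (- x) = - \<sigma> x) \<and> (\<forall>x. int n < \<bar>x\<bar> \<longrightarrow> \<sigma> x = x)"
proof
  assume "\<sigma> \<in> signed_perms n"
  then have p: "\<sigma> permutes signed_interval n"
    and o: "\<And>i. i \<in> signed_interval n \<Longrightarrow> \<sigma> (- i) = - \<sigma> i"
    by (auto simp: signed_perms_def)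
  have "\<sigma> (- x) = - \<sigma> x" for x
  proof (cases "x \<in> signed_interval n")
    case False
    then have "- x \<notin> signed_interval n" by (simp add: mem_signed_interval)
    with False p show ?thesis by (simp add: permutes_not_in)
  qed (rule o)
  moreover have "\<sigma> x = x" if "int n < \<bar>x\<bar>" for x
    using that p by (intro permutes_not_in[OF p]) (auto simp: mem_signed_interval)
  ultimately show "bij \<sigma> \<and> (\<forall>x. \<sigma> (- x) = - \<sigma> x) \<and> (\<forall>x. int n < \<bar>x\<bar> \<longrightarrow> \<sigma> x = x)"
    using permutes_bij[OF p] by blast
next
  assume a: "bij \<sigma> \<and> (\<forall>x. \<sigma> (- x) = - \<sigma> x) \<and> (\<forall>x. int n < \<bar>x\<bar> \<longrightarrow> \<sigma> x = x)"
  then have "\<sigma> (- 0) = - \<sigma> 0" by blast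
  then have "\<sigma> 0 = 0" by simp
  with a have "\<sigma> x = x" if "x \<notin> signed_interval n" for x
    using that by (cases "x = 0") (auto simp: mem_signed_interval)
  with a have "\<sigma> permutes signed_interval n"
    by (auto simp: permutes_def bij_iff)
  with a show "\<sigma> \<in> signed_perms n" by (simp add: signed_perms_def)
qed

lemma signed_perms_mono: "m \<le> n \<Longrightarrow> signed_perms m \<subseteq> signed_perms n"
  by (auto simp: signed_perms_iff)

lemma signed_perms_comp:
  "\<sigma> \<in> signed_perms n \<Longrightarrow> \<tau> \<in> signed_perms n \<Longrightarrow> \<sigma> \<circ> \<tau> \<in> signed_perms n"
  by (auto simp: signed_perms_iff bij_comp)

lemma signed_perms_inv:
  assumes "\<sigma> \<in> signed_perms n"
  shows "inv \<sigma> \<in> signed_perms n"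
proof -
  from assms have b: "bij \<sigma>" and o: "\<And>x. \<sigma> (- x) = - \<sigma> x" and f: "\<And>x. int n < \<bar>x\<bar> \<Longrightarrow> \<sigma> x = x"
    by (auto simp: signed_perms_iff)
  from b have "bij (inv \<sigma>)" by (rule bij_imp_bij_inv)
  moreover have "inv \<sigma> (- x) = - inv \<sigma> x" for x
    by (metis b o bij_inv_eq_iff)
  moreover have "inv \<sigma> x = x" if "int n < \<bar>x\<bar>" for x
    using f[OF that] by (metis b bij_inv_eq_iff)
  ultimately show ?thesis by (simp add: signed_perms_iff)
qed

lemma bij_betw_inv_signed_perms: "bij_betw inv (signed_perms n) (signed_perms n)"
  by (rule bij_betw_byWitness[where f' = inv])
    (auto simp: signed_perms_inv inv_inv_eq[of f for f :: "int \<Rightarrow> int"] dest: signed_perms_iff[THEN iffD1])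

context
  fixes n :: nat and \<sigma> :: "int \<Rightarrow> int"
  assumes \<sigma>: "\<sigma> \<in> signed_perms n"
begin

lemma signed_perm_bij: "bij \<sigma>"
  and signed_perm_minus: "\<sigma> (- x) = - \<sigma> x"
  and signed_perm_fixed: "int n < \<bar>x\<bar> \<Longrightarrow> \<sigma> x = x"
  using \<sigma> by (auto simp: signed_perms_iff)

lemma signed_perm_inj: "\<sigma> x = \<sigma> y \<longleftrightarrow> x = y"
  using signed_perm_bij by (auto simp: bij_def inj_def)

lemma signed_perm_zero: "\<sigma> 0 = 0"
  using signed_perm_minus[of 0] by simp

lemma signed_perm_eq_zero_iff: "\<sigma> x = 0 \<longleftrightarrow> x = 0"
  using signed_perm_inj[of x 0] signed_perm_zero by simp

lemma signed_perm_abs_eq_iff: "\<bar>\<sigma> x\<bar> = \<bar>\<sigma> y\<bar> \<longleftrightarrow> \<bar>x\<bar> = \<bar>y\<bar>"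
  using signed_perm_inj[of x y] signed_perm_inj[of x "- y"] by (simp add: signed_perm_minus abs_eq_iff)

lemma signed_perm_abs_abs: "\<bar>\<sigma> \<bar>x\<bar>\<bar> = \<bar>\<sigma> x\<bar>"
  by (simp add: signed_perm_abs_eq_iff)

lemma signed_perm_abs_le_iff: "\<bar>\<sigma> x\<bar> \<le> int n \<longleftrightarrow> \<bar>x\<bar> \<le> int n"
proof (cases "\<bar>x\<bar> \<le> int n")
  case True
  show ?thesis
  proof (rule ccontr)
    assume "\<not> ?thesis"
    with True have "int n < \<bar>\<sigma> x\<bar>" by simp
    \<comment> \<open>A value beyond \<open>n\<close> is itself a fixed point, so injectivity forces
      \<open>x\<close> to equal it.\<close>
    then have "\<sigma> (\<sigma> x) = \<sigma> x" by (rule signed_perm_fixed)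
    with \<open>int n < \<bar>\<sigma> x\<bar>\<close> True show False by (simp add: signed_perm_inj)
  qed
qed (simp add: signed_perm_fixed)

lemma signed_perm_abs_mem_interval: "i \<in> interval n \<Longrightarrow> \<bar>\<sigma> i\<bar> \<in> interval n"
  using signed_perm_abs_le_iff[of i] signed_perm_eq_zero_iff[of i] by auto

lemma signed_perm_abs_surj:
  assumes "j \<in> interval n"
  obtains i where "i \<in> interval n" "\<bar>\<sigma> i\<bar> = j"
proof -
  from signed_perm_bij obtain x where x: "\<sigma> x = j" by (metis bij_pointE)
  with assms have "\<bar>x\<bar> \<in> interval n"
    using signed_perm_abs_le_iff[of x] signed_perm_zero by (cases "x = 0") auto
  moreover have "\<bar>\<sigma> \<bar>x\<bar>\<bar> = j" using x assms by (simp add: signed_perm_abs_abs)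
  ultimately show thesis by (rule that)
qed

lemma signed_perm_inv_eq_iff: "inv \<sigma> y = x \<longleftrightarrow> \<sigma> x = y"
  using signed_perm_bij by (metis bij_inv_eq_iff)

end

section \<open>Absolute cycles\<close>

text \<open>On the positive integers this is the permutation whose orbits are the members of
  \<^const>\<open>abs_cycles\<close>; fixing the other integers makes it a permutation of the whole type.\<close>

definition abs_perm :: "(int \<Rightarrow> int) \<Rightarrow> int \<Rightarrow> int" where
  "abs_perm \<sigma> i = (if 0 < i then \<bar>\<sigma> i\<bar> else i)"

lemma abs_perm_permutes:
  assumes "\<sigma> \<in> signed_perms n"
  shows "abs_perm \<sigma> permutes interval n"
proof (rule inj_imp_permutes)
  show "inj_on (abs_perm \<sigma>) (interval n)"
    by (auto simp: inj_on_def abs_perm_def signed_perm_abs_eq_iff[OF assms])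
  show "abs_perm \<sigma> i \<in> interval n" if "i \<in> interval n" for i
    using signed_perm_abs_mem_interval[OF assms that] that by (simp add: abs_perm_def)
  show "abs_perm \<sigma> i = i" if "i \<notin> interval n" for i
    using that signed_perm_fixed[OF assms, of i] by (auto simp: abs_perm_def)
qed simp

lemma permutation_abs_perm: "\<sigma> \<in> signed_perms n \<Longrightarrow> permutation (abs_perm \<sigma>)"
  using abs_perm_permutes permutation_permutes by blast

text \<open>The sign of an argument does not affect the absolute value of its image, so
  \<open>abs_perm (inv \<sigma>)\<close> is a right inverse of the bijection
  \<open>abs_perm \<sigma>\<close>.\<close>

lemma abs_perm_inv:
  assumes "\<sigma> \<in> signed_perms n"
  shows "abs_perm (inv \<sigma>) = inv (abs_perm \<sigma>)"
proof
  fix y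
  have b: "bij (abs_perm \<sigma>)" using abs_perm_permutes[OF assms] by (rule permutes_bij)
  have "abs_perm \<sigma> (abs_perm (inv \<sigma>) y) = y"
    using signed_perm_abs_abs[OF assms, of "inv \<sigma> y"] signed_perm_zero[OF assms]
      bij_is_surj[OF signed_perm_bij[OF assms]]
    by (auto simp: abs_perm_def surj_f_inv_f)
  with b show "abs_perm (inv \<sigma>) y = inv (abs_perm \<sigma>) y"
    by (metis bij_inv_eq_iff)
qed

lemma orbit_abs_perm:
  assumes "\<sigma> \<in> signed_perms n" "k \<in> interval n"
  shows "orbit (\<lambda>i. \<bar>\<sigma> i\<bar>) k = orbit (abs_perm \<sigma>) k"
  by (rule orbit_cong0[where A = "interval n"])
    (use assms signed_perm_abs_mem_interval[OF assms(1)] in \<open>auto simp: abs_perm_def\<close>)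

lemma orbit_abs_perm_subset:
  "\<sigma> \<in> signed_perms n \<Longrightarrow> k \<in> interval n \<Longrightarrow> orbit (abs_perm \<sigma>) k \<subseteq> interval n"
  by (rule permutes_orbit_subset[OF abs_perm_permutes])

text \<open>Turns the parity of negative letters in a cycle into a product of signs, which can be
  reindexed along the cycle and updated factor by factor.\<close>

lemma prod_sgn_eq_one_iff:
  fixes f :: "'a \<Rightarrow> int"
  assumes "finite A" "\<And>i. i \<in> A \<Longrightarrow> f i \<noteq> 0"
  shows "(\<Prod>i\<in>A. sgn (f i)) = 1 \<longleftrightarrow> even (card {i \<in> A. f i < 0})"
proof -
  have "(\<Prod>i\<in>A. sgn (f i)) = (\<Prod>i\<in>A. if f i < 0 then - 1 else 1)"
    using assms(2) by (intro prod.cong) (auto simp: sgn_if)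
  also have "\<dots> = (- 1) ^ card {i \<in> A. f i < 0}"
    using assms(1) by (simp add: prod.If_cases Int_def)
  finally show ?thesis by (simp add: minus_one_power_iff)
qed

text \<open>The finite orbit is mapped injectively into itself by \<open>f\<close>, hence onto
  itself.\<close>

lemma prod_orbit_reindex:
  assumes f: "permutation f"
  shows "(\<Prod>i\<in>orbit f m. g (f i)) = (\<Prod>i\<in>orbit f m. g i)"
proof -
  let ?O = "orbit f m"
  have cyc: "cyclic_on f ?O" by (rule cyclic_on_orbit'[OF f])
  have inj: "inj_on f ?O"
    using permutation_bijective[OF f] by (auto simp: bij_def intro: inj_on_subset)
  have "finite ?O" using cyc by (rule finite_cyclic_on)
  moreover have "f ` ?O \<subseteq> ?O" using cyc by (auto intro: cyclic_on_inI)
  ultimately have "f ` ?O = ?O" using inj by (intro endo_inj_surj)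
  then show ?thesis using prod.reindex[OF inj, of g] by (simp add: o_def)
qed

text \<open>Trades the set of cycles for a test on single elements: each cycle is represented by its
  minimum, whose orbit is that cycle.\<close>

lemma CycB_altdef:
  assumes \<sigma>: "\<sigma> \<in> signed_perms n"
  shows "CycB n \<sigma> = {m \<in> interval n. (\<forall>y\<in>orbit (abs_perm \<sigma>) m. m \<le> y)
    \<and> (\<Prod>i\<in>orbit (abs_perm \<sigma>) m. sgn (\<sigma> i)) = 1}" (is "_ = ?R")
proof -
  let ?O = "orbit (abs_perm \<sigma>)"
  note P = permutation_abs_perm[OF \<sigma>]
  have self: "k \<in> ?O k" for k by (rule permutation_self_in_orbit[OF P])
  have fin: "finite (?O k)" for k by (rule finite_orbit[OF self])
  have sub: "?O k \<subseteq> interval n" if "k \<in> interval n" for k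
    by (rule orbit_abs_perm_subset[OF \<sigma> that])
  have par: "(\<Prod>i\<in>?O k. sgn (\<sigma> i)) = 1 \<longleftrightarrow> even (card {i \<in> ?O k. \<sigma> i < 0})"
    if "k \<in> interval n" for k
    using sub[OF that] signed_perm_eq_zero_iff[OF \<sigma>]
    by (intro prod_sgn_eq_one_iff[OF fin]) auto
  have cyc: "CycB n \<sigma> = {Min (?O k) | k. k \<in> interval n \<and> even (card {i \<in> ?O k. \<sigma> i < 0})}"
    unfolding CycB_def abs_cycles_def using orbit_abs_perm[OF \<sigma>] by fastforce
  show ?thesis
  proof (intro equalityI subsetI)
    fix m assume "m \<in> CycB n \<sigma>"
    then obtain k where k: "m = Min (?O k)" "k \<in> interval n" "even (card {i \<in> ?O k. \<sigma> i < 0})"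
      unfolding cyc by blast
    have m: "m \<in> ?O k" unfolding k by (rule Min_in[OF fin orbit_nonempty])
    have eq: "?O m = ?O k" by (rule orbit_cyclic_eq3[OF cyclic_on_orbit'[OF P] m])
    have "m \<in> interval n" using m sub[OF k(2)] by blast
    with k par[of m] eq fin[of k] show "m \<in> ?R" by auto
  next
    fix m assume m: "m \<in> ?R"
    then have "Min (?O m) = m" using self fin by (intro Min_eqI) auto
    with m par[of m] show "m \<in> CycB n \<sigma>" unfolding cyc by force
  qed
qed

section \<open>The three statistics under inversion\<close>

text \<open>Inversion keeps every orbit, and \<open>inv \<sigma>\<close> has at
  \<open>\<bar>\<sigma> i\<bar>\<close> the sign that \<open>\<sigma>\<close> has at
  \<open>i\<close>. The factors of the sign product are merely shifted one step along the
  cycle.\<close>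

lemma CycB_inv:
  assumes \<sigma>: "\<sigma> \<in> signed_perms n"
  shows "CycB n (inv \<sigma>) = CycB n \<sigma>"
proof -
  let ?p = "abs_perm \<sigma>"
  note P = permutation_abs_perm[OF \<sigma>]
  have orb: "orbit (abs_perm (inv \<sigma>)) m = orbit ?p m" for m
    by (simp add: abs_perm_inv[OF \<sigma>] orbit_inv_eq[OF P])
  have "(\<Prod>i\<in>orbit ?p m. sgn (inv \<sigma> i)) = (\<Prod>i\<in>orbit ?p m. sgn (\<sigma> i))"
    if m: "m \<in> interval n" for m
  proof -
    let ?O = "orbit ?p m"
    have "(\<Prod>i\<in>?O. sgn (inv \<sigma> i)) = (\<Prod>i\<in>?O. sgn (inv \<sigma> (?p i)))"
      by (rule prod_orbit_reindex[OF P, symmetric])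
    also have "\<dots> = (\<Prod>i\<in>?O. sgn (\<sigma> i))"
    proof (rule prod.cong[OF refl])
      fix i assume "i \<in> ?O"
      with orbit_abs_perm_subset[OF \<sigma> m] have i: "0 < i" by auto
      show "sgn (inv \<sigma> (?p i)) = sgn (\<sigma> i)"
      proof (cases "0 < \<sigma> i")
        case True
        then have "inv \<sigma> (?p i) = i" using i by (simp add: abs_perm_def signed_perm_inv_eq_iff[OF \<sigma>])
        with True i show ?thesis by simp
      next
        case False
        then have neg: "\<sigma> i < 0" using i signed_perm_eq_zero_iff[OF \<sigma>, of i] by linarith
        then have "inv \<sigma> (?p i) = - i" using i
          by (simp add: abs_perm_def signed_perm_inv_eq_iff[OF \<sigma>] signed_perm_minus[OF \<sigma>])
        with neg i show ?thesis by simp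
      qed
    qed
    finally show ?thesis .
  qed
  then show ?thesis
    unfolding CycB_altdef[OF \<sigma>] CycB_altdef[OF signed_perms_inv[OF \<sigma>]] orb by auto
qed

text \<open>Inversion exchanges positions with values. The two record conditions are contrapositives
  of each other, up to ties, and ties are excluded because distinct positions carry distinct
  absolute values.\<close>

lemma LmapB_inv:
  assumes \<sigma>: "\<sigma> \<in> signed_perms n"
  shows "LmapB n (inv \<sigma>) = RmilB n \<sigma>"
proof -
  note \<tau> = signed_perms_inv[OF \<sigma>]
  have key: "(\<forall>j\<in>interval n. j < \<sigma> i \<longrightarrow> \<bar>inv \<sigma> j\<bar> < i) \<longleftrightarrow> (\<forall>j\<in>interval n. i < j \<longrightarrow> \<sigma> i < \<bar>\<sigma> j\<bar>)"
    (is "?L \<longleftrightarrow> ?R") if i: "i \<in> interval n" "0 < \<sigma> i" for i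
  proof
    assume L: ?L
    show ?R
    proof (intro ballI impI)
      fix j assume j: "j \<in> interval n" "i < j"
      have "\<bar>inv \<sigma> \<bar>\<sigma> j\<bar>\<bar> = j"
        using signed_perm_abs_abs[OF \<tau>, of "\<sigma> j"] signed_perm_inv_eq_iff[OF \<sigma>, of "\<sigma> j" j] j by auto
      with L signed_perm_abs_mem_interval[OF \<sigma> j(1)] j have "\<not> \<bar>\<sigma> j\<bar> < \<sigma> i" by force
      moreover have "\<bar>\<sigma> j\<bar> \<noteq> \<bar>\<sigma> i\<bar>" using i j unfolding signed_perm_abs_eq_iff[OF \<sigma>] by auto
      ultimately show "\<sigma> i < \<bar>\<sigma> j\<bar>" using i by linarith
    qed
  next
    assume R: ?R
    show ?L
    proof (intro ballI impI)
      fix j assume j: "j \<in> interval n" "j < \<sigma> i"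
      have *: "\<bar>\<sigma> \<bar>inv \<sigma> j\<bar>\<bar> = j"
        using signed_perm_abs_abs[OF \<sigma>, of "inv \<sigma> j"] signed_perm_inv_eq_iff[OF \<sigma>, of j "inv \<sigma> j"] j by auto
      with R signed_perm_abs_mem_interval[OF \<tau> j(1)] j have "\<not> i < \<bar>inv \<sigma> j\<bar>" by force
      moreover have "\<bar>inv \<sigma> j\<bar> \<noteq> i" using * i j by auto
      ultimately show "\<bar>inv \<sigma> j\<bar> < i" by linarith
    qed
  qed
  show ?thesis
  proof (intro equalityI subsetI)
    fix v assume v: "v \<in> LmapB n (inv \<sigma>)"
    then have "inv \<sigma> v \<in> interval n"
      using signed_perm_abs_mem_interval[OF \<tau>, of v] by (auto simp: LmapB_def)
    moreover have s: "\<sigma> (inv \<sigma> v) = v" using signed_perm_inv_eq_iff[OF \<sigma>] by blast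
    ultimately have "\<forall>j\<in>interval n. inv \<sigma> v < j \<longrightarrow> \<sigma> (inv \<sigma> v) < \<bar>\<sigma> j\<bar>"
      using v key[of "inv \<sigma> v"] by (simp add: LmapB_def)
    with \<open>inv \<sigma> v \<in> interval n\<close> s v show "v \<in> RmilB n \<sigma>"
      unfolding RmilB_def LmapB_def mem_Collect_eq by (intro exI[of _ "inv \<sigma> v"]) simp
  next
    fix v assume "v \<in> RmilB n \<sigma>"
    then obtain i where i: "v = \<sigma> i" "i \<in> interval n" "0 < \<sigma> i" "\<forall>j\<in>interval n. i < j \<longrightarrow> \<sigma> i < \<bar>\<sigma> j\<bar>"
      by (auto simp: RmilB_def)
    moreover have "inv \<sigma> v = i" using i signed_perm_inv_eq_iff[OF \<sigma>] by blast
    ultimately show "v \<in> LmapB n (inv \<sigma>)"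
      using key[of i] signed_perm_abs_mem_interval[OF \<sigma>, of i] by (auto simp: LmapB_def)
  qed
qed

lemma RmilB_inv:
  assumes \<sigma>: "\<sigma> \<in> signed_perms n"
  shows "RmilB n (inv \<sigma>) = LmapB n \<sigma>"
  using LmapB_inv[OF signed_perms_inv[OF \<sigma>]] inv_inv_eq[OF signed_perm_bij[OF \<sigma>]] by simp

section \<open>Adding a largest element\<close>

text \<open>The right factor fixes the top element, so the last letter of
  \<open>r v \<circ> \<sigma>\<close> is \<open>v\<close>. Reading it off determines
  \<open>r v\<close>, and cancelling that factor recovers \<open>\<sigma>\<close>.\<close>

lemma bij_betw_signed_perms_Suc:
  assumes r: "\<And>v. v \<in> signed_interval (Suc n) \<Longrightarrow> r v \<in> signed_perms (Suc n)"
    and rN: "\<And>v. v \<in> signed_interval (Suc n) \<Longrightarrow> r v (int (Suc n)) = v"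
  shows "bij_betw (\<lambda>(\<sigma>, v). r v \<circ> \<sigma>) (signed_perms n \<times> signed_interval (Suc n))
    (signed_perms (Suc n))"
proof -
  let ?N = "int (Suc n)"
  have mem: "\<sigma> ?N \<in> signed_interval (Suc n)" if "\<sigma> \<in> signed_perms (Suc n)" for \<sigma>
    using signed_perm_abs_le_iff[OF that, of ?N] signed_perm_eq_zero_iff[OF that, of ?N]
    by (simp add: mem_signed_interval)
  have small: "inv (r (\<sigma> ?N)) \<circ> \<sigma> \<in> signed_perms n" if \<sigma>: "\<sigma> \<in> signed_perms (Suc n)" for \<sigma>
  proof -
    let ?\<rho> = "r (\<sigma> ?N)"
    have m: "inv ?\<rho> \<circ> \<sigma> \<in> signed_perms (Suc n)"
      by (intro signed_perms_comp signed_perms_inv r mem \<sigma>)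
    have "inv ?\<rho> (\<sigma> ?N) = ?N"
      using signed_perm_inv_eq_iff[OF r[OF mem[OF \<sigma>]]] rN[OF mem[OF \<sigma>]] by blast
    then have N: "(inv ?\<rho> \<circ> \<sigma>) ?N = ?N" by simp
    have "(inv ?\<rho> \<circ> \<sigma>) x = x" if "int n < \<bar>x\<bar>" for x
    proof -
      \<comment> \<open>Only \<open>?N\<close> and \<open>- ?N\<close> separate the two ranges;
        oddness settles the second.\<close>
      have "int (Suc n) < \<bar>x\<bar> \<or> x = ?N \<or> x = - ?N" using that by linarith
      then show ?thesis
        using N signed_perm_fixed[OF m, of x] signed_perm_minus[OF m, of ?N] by metis
    qed
    with m show ?thesis unfolding signed_perms_iff by blast
  qed
  have fixN: "\<sigma> ?N = ?N" if "\<sigma> \<in> signed_perms n" for \<sigma>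
    by (rule signed_perm_fixed[OF that]) simp
  have inv1: "inv (r v) \<circ> (r v \<circ> \<sigma>) = \<sigma>" if "v \<in> signed_interval (Suc n)" for v \<sigma>
    using bij_is_inj[OF signed_perm_bij[OF r[OF that]]] by (simp add: o_assoc[symmetric] fun_eq_iff)
  have inv2: "r (\<sigma> ?N) \<circ> (inv (r (\<sigma> ?N)) \<circ> \<sigma>) = \<sigma>" if "\<sigma> \<in> signed_perms (Suc n)" for \<sigma>
    using bij_is_surj[OF signed_perm_bij[OF r[OF mem[OF that]]]] by (simp add: fun_eq_iff surj_f_inv_f)
  have big: "r v \<circ> \<sigma> \<in> signed_perms (Suc n)"
    if "\<sigma> \<in> signed_perms n" "v \<in> signed_interval (Suc n)" for v \<sigma>
    using that signed_perms_mono[of n "Suc n"] by (intro signed_perms_comp r) auto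
  show ?thesis
    by (rule bij_betw_byWitness[where f' = "\<lambda>\<sigma>. (inv (r (\<sigma> ?N)) \<circ> \<sigma>, \<sigma> ?N)"])
      (auto simp: fixN rN mem small big inv1 inv2 simp del: of_nat_Suc)
qed

text \<open>The last letter \<open>v\<close> is a right-to-left minimum iff it is positive, and it
  rules out earlier letters of absolute value \<open>\<bar>v\<bar>\<close> or more. Below
  \<open>\<bar>v\<bar>\<close> nothing moves, and by injectivity no other letter drops below
  \<open>\<bar>v\<bar>\<close>, so comparisons with small letters survive.\<close>

lemma RmilB_comp:
  assumes \<sigma>: "\<sigma> \<in> signed_perms n" and \<rho>: "\<rho> \<in> signed_perms (Suc n)"
    and v: "\<rho> (int (Suc n)) = v" and fixed: "\<And>x. \<bar>x\<bar> < \<bar>v\<bar> \<Longrightarrow> \<rho> x = x"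
  shows "RmilB (Suc n) (\<rho> \<circ> \<sigma>) = {u \<in> RmilB n \<sigma>. u < \<bar>v\<bar>} \<union> {u. u = v \<and> 0 < v}"
proof -
  let ?N = "int (Suc n)"
  have \<sigma>N: "\<sigma> ?N = ?N" by (rule signed_perm_fixed[OF \<sigma>]) simp
  have int: "i \<in> interval (Suc n) \<longleftrightarrow> i \<in> interval n \<or> i = ?N" for i by auto
  \<comment> \<open>A small image is fixed by \<open>\<rho>\<close>, and injectivity cancels one
    application.\<close>
  have small: "\<rho> x = x" if "\<bar>\<rho> x\<bar> < \<bar>v\<bar>" for x
    using fixed[OF that] by (simp add: signed_perm_inj[OF \<rho>])
  have large: "\<bar>v\<bar> < \<bar>\<rho> x\<bar>" if "\<bar>v\<bar> \<le> \<bar>x\<bar>" "\<bar>x\<bar> \<le> int n" for x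
  proof -
    have "\<bar>\<rho> x\<bar> \<noteq> \<bar>v\<bar>" using that signed_perm_abs_eq_iff[OF \<rho>, of x ?N] v by auto
    moreover have "\<not> \<bar>\<rho> x\<bar> < \<bar>v\<bar>" using small[of x] that by auto
    ultimately show ?thesis by linarith
  qed
  have less: "u < \<bar>\<rho> (\<sigma> j)\<bar> \<longleftrightarrow> u < \<bar>\<sigma> j\<bar>" if "u < \<bar>v\<bar>" "j \<in> interval n" for u j
  proof (cases "\<bar>\<sigma> j\<bar> < \<bar>v\<bar>")
    case False
    with large[of "\<sigma> j"] signed_perm_abs_mem_interval[OF \<sigma>, of j] that show ?thesis by auto
  qed (simp add: fixed)
  show ?thesis
  proof (intro equalityI subsetI)
    fix u assume "u \<in> RmilB (Suc n) (\<rho> \<circ> \<sigma>)"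
    then obtain i where i: "u = \<rho> (\<sigma> i)" "i \<in> interval (Suc n)" "0 < u"
      "\<And>j. j \<in> interval (Suc n) \<Longrightarrow> i < j \<Longrightarrow> u < \<bar>\<rho> (\<sigma> j)\<bar>"
      by (auto simp: RmilB_def)
    show "u \<in> {u \<in> RmilB n \<sigma>. u < \<bar>v\<bar>} \<union> {u. u = v \<and> 0 < v}"
    proof (cases "i = ?N")
      case True
      with i \<sigma>N v show ?thesis by auto
    next
      case False
      with i(2) have i': "i \<in> interval n" by auto
      with i(4)[of ?N] \<sigma>N v have uv: "u < \<bar>v\<bar>" by auto
      with i(1,3) small[of "\<sigma> i"] have u: "u = \<sigma> i" by auto
      have "u < \<bar>\<sigma> j\<bar>" if "j \<in> interval n" "i < j" for j
        using i(4)[of j] that less[OF uv that(1)] by auto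
      with i' u uv i(3) show ?thesis by (auto simp: RmilB_def)
    qed
  next
    fix u assume "u \<in> {u \<in> RmilB n \<sigma>. u < \<bar>v\<bar>} \<union> {u. u = v \<and> 0 < v}"
    then consider "u \<in> RmilB n \<sigma>" "u < \<bar>v\<bar>" | "u = v" "0 < v" by blast
    then show "u \<in> RmilB (Suc n) (\<rho> \<circ> \<sigma>)"
    proof cases
      case 1
      then obtain i where i: "u = \<sigma> i" "i \<in> interval n" "0 < u"
        "\<And>j. j \<in> interval n \<Longrightarrow> i < j \<Longrightarrow> u < \<bar>\<sigma> j\<bar>"
        by (auto simp: RmilB_def)
      have "\<rho> u = u" using 1 i(3) by (intro fixed) auto
      moreover have "u < \<bar>\<rho> (\<sigma> j)\<bar>" if "j \<in> interval (Suc n)" "i < j" for j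
        using that i(4)[of j] less[OF 1(2), of j] \<sigma>N v 1(2) unfolding int by auto
      ultimately show ?thesis
        using i int[of i] unfolding RmilB_def by (auto intro!: exI[of _ i])
    next
      case 2
      with \<sigma>N v show ?thesis unfolding RmilB_def by (auto intro!: exI[of _ ?N])
    qed
  qed
qed

lemma signed_permsI:
  assumes "inj_on f (signed_interval n)" "\<And>x. x \<in> signed_interval n \<Longrightarrow> f x \<in> signed_interval n"
    and "\<And>x. x \<notin> signed_interval n \<Longrightarrow> f x = x" "\<And>x. f (- x) = - f x"
  shows "f \<in> signed_perms n"
  using inj_imp_permutes[OF assms(1) finite_signed_interval assms(2,3)] assms(4)
  by (simp add: signed_perms_def)

text \<open>Left multiplication by \<open>signed_shift N v\<close> appends the letter \<open>v\<close> to a signed word on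
  \<open>1, \<dots>, N - 1\<close>, raising the letters of absolute value at least \<open>\<bar>v\<bar>\<close>.\<close>

definition signed_shift :: "int \<Rightarrow> int \<Rightarrow> int \<Rightarrow> int" where
  "signed_shift N v x = (if x = N then v else if x = - N then - v
     else if \<bar>v\<bar> \<le> \<bar>x\<bar> \<and> \<bar>x\<bar> < N then x + sgn x else x)"

lemma signed_shift_mem:
  assumes "v \<in> signed_interval (Suc n)"
  shows "signed_shift (int (Suc n)) v \<in> signed_perms (Suc n)"
proof (rule signed_permsI)
  show "inj_on (signed_shift (int (Suc n)) v) (signed_interval (Suc n))"
    using assms by (auto simp: inj_on_def signed_shift_def mem_signed_interval sgn_if split: if_splits)
qed (use assms in \<open>auto simp: signed_shift_def mem_signed_interval sgn_if split: if_splits\<close>)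

text \<open>On letters up to \<open>n\<close> the shift keeps signs and the order of absolute
  values, so the old positions are unaffected and only the last one needs a separate
  argument.\<close>

lemma LmapB_signed_shift:
  assumes \<sigma>: "\<sigma> \<in> signed_perms n" and v: "v \<in> signed_interval (Suc n)"
  shows "LmapB (Suc n) (signed_shift (int (Suc n)) v \<circ> \<sigma>)
    = LmapB n \<sigma> \<union> {i. i = int (Suc n) \<and> v = int (Suc n)}"
proof -
  let ?N = "int (Suc n)"
  let ?\<rho> = "signed_shift ?N v"
  have comp: "?\<rho> \<circ> \<sigma> \<in> signed_perms (Suc n)"
    using \<sigma> signed_perms_mono[of n "Suc n"] by (intro signed_perms_comp signed_shift_mem v) auto
  have \<sigma>N: "\<sigma> ?N = ?N" by (rule signed_perm_fixed[OF \<sigma>]) simp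
  have \<rho>N: "?\<rho> ?N = v" by (simp add: signed_shift_def)
  have int: "i \<in> interval (Suc n) \<longleftrightarrow> i \<in> interval n \<or> i = ?N" for i by auto
  have pos: "0 < ?\<rho> x \<longleftrightarrow> 0 < x" if "\<bar>x\<bar> \<le> int n" for x
    using that by (auto simp: signed_shift_def sgn_if)
  have "\<bar>?\<rho> x\<bar> = (if \<bar>v\<bar> \<le> \<bar>x\<bar> then \<bar>x\<bar> + 1 else \<bar>x\<bar>)" if "\<bar>x\<bar> \<le> int n" for x
    using that v by (auto simp: signed_shift_def sgn_if mem_signed_interval)
  then have less: "\<bar>?\<rho> x\<bar> < \<bar>?\<rho> y\<bar> \<longleftrightarrow> \<bar>x\<bar> < \<bar>y\<bar>" if "\<bar>x\<bar> \<le> int n" "\<bar>y\<bar> \<le> int n" for x y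
    using that by (simp del: of_nat_Suc) linarith
  have bd: "\<bar>\<sigma> i\<bar> \<le> int n" if "i \<in> interval n" for i
    using signed_perm_abs_mem_interval[OF \<sigma> that] by simp
  have old: "i \<in> LmapB (Suc n) (?\<rho> \<circ> \<sigma>) \<longleftrightarrow> i \<in> LmapB n \<sigma>" if i: "i \<in> interval n" for i
  proof -
    have "i \<in> LmapB (Suc n) (?\<rho> \<circ> \<sigma>)
      \<longleftrightarrow> 0 < ?\<rho> (\<sigma> i) \<and> (\<forall>j\<in>interval n. j < i \<longrightarrow> \<bar>?\<rho> (\<sigma> j)\<bar> < \<bar>?\<rho> (\<sigma> i)\<bar>)"
      using i unfolding LmapB_def int Ball_def by auto
    also have "\<dots> \<longleftrightarrow> 0 < \<sigma> i \<and> (\<forall>j\<in>interval n. j < i \<longrightarrow> \<bar>\<sigma> j\<bar> < \<bar>\<sigma> i\<bar>)"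
      using pos[OF bd[OF i]] less[OF bd bd[OF i]] by (simp del: of_nat_Suc)
    also have "\<dots> \<longleftrightarrow> i \<in> LmapB n \<sigma>"
      using i unfolding LmapB_def by auto
    finally show ?thesis .
  qed
  have new: "?N \<in> LmapB (Suc n) (?\<rho> \<circ> \<sigma>) \<longleftrightarrow> v = ?N"
  proof
    assume L: "?N \<in> LmapB (Suc n) (?\<rho> \<circ> \<sigma>)"
    \<comment> \<open>The absolute value \<open>?N\<close> occurs somewhere; before the last
      position it would force \<open>v\<close> above \<open>?N\<close>.\<close>
    obtain j where j: "j \<in> interval (Suc n)" "\<bar>(?\<rho> \<circ> \<sigma>) j\<bar> = ?N"
      using signed_perm_abs_surj[OF comp, of ?N] by auto
    show "v = ?N"
    proof (cases "j = ?N")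
      case True
      with j L \<sigma>N \<rho>N show ?thesis by (auto simp: LmapB_def)
    next
      case False
      with j(1) have "j < ?N" by auto
      with L j have "?N < v" by (auto simp: LmapB_def \<sigma>N \<rho>N simp del: of_nat_Suc)
      with v show ?thesis by (auto simp: mem_signed_interval)
    qed
  next
    assume "v = ?N"
    then have "?\<rho> x = x" if "\<bar>x\<bar> \<le> int n" for x using that by (auto simp: signed_shift_def)
    with bd have "\<bar>?\<rho> (\<sigma> j)\<bar> < ?N" if "j \<in> interval n" for j
      using that by (metis of_nat_Suc zle_add1_eq_le add.commute)
    moreover have "(?\<rho> \<circ> \<sigma>) ?N = ?N" using \<sigma>N \<rho>N \<open>v = ?N\<close> by simp
    ultimately show "?N \<in> LmapB (Suc n) (?\<rho> \<circ> \<sigma>)"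
      unfolding LmapB_def int Ball_def mem_Collect_eq by (auto simp del: of_nat_Suc)
  qed
  have "LmapB (Suc n) (?\<rho> \<circ> \<sigma>) \<subseteq> interval (Suc n)" "LmapB n \<sigma> \<subseteq> interval n"
    by (auto simp: LmapB_def)
  with old new int show ?thesis by blast
qed

text \<open>Left multiplication by \<open>signed_transpose N v\<close> inserts \<open>N\<close> in front of \<open>\<bar>v\<bar>\<close> into its absolute
  cycle, or creates the new cycle \<open>{N}\<close> if \<open>\<bar>v\<bar> = N\<close>.\<close>

definition signed_transpose :: "int \<Rightarrow> int \<Rightarrow> int \<Rightarrow> int" where
  "signed_transpose N v x = (if x = N then v else if x = - N then - v
     else if x = v then N else if x = - v then - N else x)"

lemma signed_transpose_mem:
  assumes "v \<in> signed_interval (Suc n)"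
  shows "signed_transpose (int (Suc n)) v \<in> signed_perms (Suc n)"
proof (rule signed_permsI)
  show "inj_on (signed_transpose (int (Suc n)) v) (signed_interval (Suc n))"
  \<comment> \<open>A signed transposition is an involution, hence its own left inverse.\<close>
  proof (rule inj_on_inverseI)
    show "signed_transpose (int (Suc n)) v (signed_transpose (int (Suc n)) v x) = x" for x
      using assms by (simp add: signed_transpose_def mem_signed_interval del: of_nat_Suc)
  qed
qed (use assms in \<open>auto simp: signed_transpose_def mem_signed_interval split: if_splits\<close>)

text \<open>Composing with the transposition reroutes the arrow into \<open>k\<close> through the
  fixed point \<open>N\<close> of \<open>q\<close>. Only the orbit that contains \<open>k\<close>
  grows, by \<open>N\<close> alone.\<close>

lemma orbit_transpose_comp:
  assumes q: "permutation q" and N: "q N = N" and x: "x \<noteq> N"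
  shows "orbit (transpose N k \<circ> q) x = orbit q x \<union> {y. y = N \<and> k \<in> orbit q x}"
proof -
  let ?p = "transpose N k \<circ> q"
  have p: "permutation ?p" by (intro permutation_compose permutation_swap_id q)
  have self: "y \<in> orbit q y" for y by (rule permutation_self_in_orbit[OF q])
  have inj: "q y = N \<longleftrightarrow> y = N" for y
    using permutation_bijective[OF q] N by (metis bij_pointE)
  have N_notin: "N \<notin> orbit q x"
  proof
    assume "N \<in> orbit q x"
    \<comment> \<open>Orbits are symmetric here, so \<open>x\<close> would lie in the one-point
      orbit of \<open>N\<close>.\<close>
    with self have "x \<in> orbit q N" by (rule orbit_swap)
    with N x show False using orbit_eq_singleton_iff[of q N] by auto
  qed
  show ?thesis
  proof (cases "k \<in> orbit q x")
    case False
    have "?p s = q s" if "s \<in> orbit q x" for s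
    proof -
      have "q s \<in> orbit q x" using that by (rule orbit.step)
      with False N_notin show ?thesis by (auto simp: transpose_def)
    qed
    then have "orbit ?p x = orbit q x" by (intro orbit_cong self)
    with False show ?thesis by simp
  next
    case True
    with N_notin have kN: "k \<noteq> N" by blast
    have pN: "?p N = k" by (simp add: N)
    have "orbit ?p x \<subseteq> insert N (orbit q x)"
    proof
      fix y assume "y \<in> orbit ?p x"
      then show "y \<in> insert N (orbit q x)"
      proof induction
        case base
        show ?case using orbit.base[of q x] True by (auto simp: transpose_def)
      next
        case (step y)
        then show ?case using orbit.step[of y q x] True pN by (auto simp: transpose_def)
      qed
    qed
    moreover have "orbit q x \<subseteq> orbit ?p x - {N}"
    proof -
      have closed: "q y \<in> orbit ?p x - {N}" if y: "y \<in> orbit ?p x - {N}" for y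
      proof (cases "q y = k")
        case True
        \<comment> \<open>A step of \<open>q\<close> into \<open>k\<close> becomes two steps of
          \<open>?p\<close>, with \<open>N\<close> in between.\<close>
        have "?p y \<in> orbit ?p x" using y by (intro orbit.step) blast
        then have "?p (?p y) \<in> orbit ?p x" by (rule orbit.step)
        moreover have "?p (?p y) = k" using True pN by simp
        ultimately show ?thesis using True kN by simp
      next
        case False
        have "q y \<noteq> N" using y inj by simp
        with False have "?p y = q y" by (simp add: transpose_def)
        moreover have "?p y \<in> orbit ?p x" using y by (intro orbit.step) blast
        ultimately show ?thesis using \<open>q y \<noteq> N\<close> by simp
      qed
      have x': "x \<in> orbit ?p x - {N}" using permutation_self_in_orbit[OF p] x by simp
      show ?thesis
      proof
        fix y assume "y \<in> orbit q x"
        then show "y \<in> orbit ?p x - {N}" by induction (rule closed[OF x'], rule closed)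
      qed
    qed
    moreover have "N \<in> orbit ?p x"
    proof -
      have "k \<in> orbit ?p x" using True calculation(2) by blast
      moreover have "N \<in> orbit ?p k"
        using permutation_orbit_step[OF p, of N] permutation_self_in_orbit[OF p, of N] pN by simp
      ultimately show ?thesis by (rule orbit_trans[rotated])
    qed
    ultimately show ?thesis using True by blast
  qed
qed

text \<open>Inserting the top element keeps the minimum of each old cycle. The sign at the
  predecessor of \<open>\<bar>v\<bar>\<close> is multiplied by \<open>sgn v\<close>, and the new
  element adds another factor \<open>sgn v\<close>; the two cancel. The new element is the minimum
  of its cycle only when alone, and is then counted iff \<open>v\<close> is positive.\<close>

lemma CycB_signed_transpose:
  assumes \<sigma>: "\<sigma> \<in> signed_perms n" and v: "v \<in> signed_interval (Suc n)"
  shows "CycB (Suc n) (signed_transpose (int (Suc n)) v \<circ> \<sigma>)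
    = CycB n \<sigma> \<union> {i. i = int (Suc n) \<and> v = int (Suc n)}"
proof -
  define N where "N = int (Suc n)"
  define \<tau> where "\<tau> = signed_transpose N v"
  define p where "p = abs_perm (\<tau> \<circ> \<sigma>)"
  define q where "q = abs_perm \<sigma>"
  have comp: "\<tau> \<circ> \<sigma> \<in> signed_perms (Suc n)"
    using \<sigma> signed_perms_mono[of n "Suc n"] unfolding \<tau>_def N_def
    by (intro signed_perms_comp signed_transpose_mem v) auto
  have Npos: "0 < N" "int n < N" by (simp_all add: N_def)
  have \<sigma>N: "\<sigma> N = N" by (rule signed_perm_fixed[OF \<sigma>]) (simp add: N_def)
  have \<tau>N: "\<tau> N = v" by (simp add: \<tau>_def signed_transpose_def)
  have vN: "v \<noteq> 0" "\<bar>v\<bar> \<le> N" using v by (auto simp: mem_signed_interval N_def)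
  have int: "i \<in> interval (Suc n) \<longleftrightarrow> i \<in> interval n \<or> i = N" for i by (auto simp: N_def)
  have abs\<tau>: "\<bar>\<tau> y\<bar> = transpose N \<bar>v\<bar> \<bar>y\<bar>" for y
    using Npos vN by (auto simp: \<tau>_def signed_transpose_def transpose_def)
  have pq: "p = transpose N \<bar>v\<bar> \<circ> q"
    using Npos vN by (auto simp: fun_eq_iff p_def q_def abs_perm_def abs\<tau> transpose_def)
  have perm_q: "permutation q" unfolding q_def by (rule permutation_abs_perm[OF \<sigma>])
  have qN: "q N = N" using Npos by (simp add: q_def abs_perm_def \<sigma>N)
  have pN: "p N = \<bar>v\<bar>" by (simp add: pq qN)
  have cond: "((\<forall>y\<in>orbit p m. m \<le> y) \<and> (\<Prod>i\<in>orbit p m. sgn ((\<tau> \<circ> \<sigma>) i)) = 1) \<longleftrightarrow>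
    ((\<forall>y\<in>orbit q m. m \<le> y) \<and> (\<Prod>i\<in>orbit q m. sgn (\<sigma> i)) = 1)" if m: "m \<in> interval n" for m
  proof -
    let ?O = "orbit q m"
    have O: "?O \<subseteq> interval n" unfolding q_def by (rule orbit_abs_perm_subset[OF \<sigma> m])
    have fin: "finite ?O" by (rule finite_orbit[OF permutation_self_in_orbit[OF perm_q]])
    have mN: "m < N" using m Npos by simp
    have O': "orbit p m = ?O \<union> {y. y = N \<and> \<bar>v\<bar> \<in> ?O}"
      unfolding pq by (rule orbit_transpose_comp[OF perm_q qN]) (use mN in simp)
    have "N \<notin> ?O" using O Npos by auto
    \<comment> \<open>Within \<open>?O\<close> only a letter \<open>v\<close> or \<open>- v\<close>
      changes, to \<open>N\<close> or \<open>- N\<close>; the factor \<open>sgn v\<close> accounts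
      for both cases.\<close>
    have "sgn (\<tau> (\<sigma> i)) = sgn (\<sigma> i) * (if q i = \<bar>v\<bar> then sgn v else 1)" if i: "i \<in> ?O" for i
    proof -
      have "i \<in> interval n" using O i by blast
      then have "q i = \<bar>\<sigma> i\<bar>" "\<bar>\<sigma> i\<bar> < N"
        using signed_perm_abs_mem_interval[OF \<sigma>, of i] Npos by (auto simp: q_def abs_perm_def)
      then show ?thesis using vN Npos by (auto simp: \<tau>_def signed_transpose_def sgn_if)
    qed
    then have "(\<Prod>i\<in>?O. sgn (\<tau> (\<sigma> i))) = (\<Prod>i\<in>?O. sgn (\<sigma> i) * (if q i = \<bar>v\<bar> then sgn v else 1))"
      by (rule prod.cong[OF refl])
    \<comment> \<open>Reindexing by \<open>q\<close> turns the condition on \<open>q i\<close> into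
      one on \<open>i\<close>, so the extra factor enters once, exactly if
      \<open>\<bar>v\<bar>\<close> lies in the orbit.\<close>
    also have "\<dots> = (\<Prod>i\<in>?O. sgn (\<sigma> i)) * (\<Prod>i\<in>?O. if i = \<bar>v\<bar> then sgn v else 1)"
      unfolding prod.distrib
      using prod_orbit_reindex[OF perm_q, of "\<lambda>i. if i = \<bar>v\<bar> then sgn v else 1" m] by simp
    also have "\<dots> = (\<Prod>i\<in>?O. sgn (\<sigma> i)) * (if \<bar>v\<bar> \<in> ?O then sgn v else 1)"
      using fin by simp
    finally have prodO: "(\<Prod>i\<in>?O. sgn (\<tau> (\<sigma> i)))
      = (\<Prod>i\<in>?O. sgn (\<sigma> i)) * (if \<bar>v\<bar> \<in> ?O then sgn v else 1)" .
    have "(\<Prod>i\<in>orbit p m. sgn ((\<tau> \<circ> \<sigma>) i)) = (\<Prod>i\<in>?O. sgn (\<sigma> i))"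
    proof (cases "\<bar>v\<bar> \<in> ?O")
      case True
      then have "orbit p m = insert N ?O" using O' by auto
      then have "(\<Prod>i\<in>orbit p m. sgn ((\<tau> \<circ> \<sigma>) i)) = sgn v * (\<Prod>i\<in>?O. sgn (\<tau> (\<sigma> i)))"
        using fin \<open>N \<notin> ?O\<close> by (simp add: \<sigma>N \<tau>N)
      also have "\<dots> = (\<Prod>i\<in>?O. sgn (\<sigma> i))"
        using True vN by (cases "0 < v") (simp_all add: prodO)
      finally show ?thesis .
    next
      case False
      then have "orbit p m = ?O" using O' by auto
      with False prodO show ?thesis by simp
    qed
    moreover have "(\<forall>y\<in>orbit p m. m \<le> y) \<longleftrightarrow> (\<forall>y\<in>?O. m \<le> y)"
      using O' mN by auto
    ultimately show ?thesis by simp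
  qed
  have new: "((\<forall>y\<in>orbit p N. N \<le> y) \<and> (\<Prod>i\<in>orbit p N. sgn ((\<tau> \<circ> \<sigma>) i)) = 1) \<longleftrightarrow> v = N"
  proof (cases "\<bar>v\<bar> = N")
    case True
    then have "orbit p N = {N}" by (simp add: orbit_eq_singleton_iff pN)
    then show ?thesis using True Npos vN by (cases "0 < v") (simp_all add: \<sigma>N \<tau>N)
  next
    case False
    \<comment> \<open>The orbit of \<open>N\<close> contains the smaller element
      \<open>\<bar>v\<bar>\<close>, so both sides are false.\<close>
    moreover have "\<bar>v\<bar> \<in> orbit p N" using orbit.base[of p N] pN by simp
    ultimately show ?thesis using vN by force
  qed
  have "CycB (Suc n) (\<tau> \<circ> \<sigma>) = CycB n \<sigma> \<union> {i. i = N \<and> v = N}"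
    unfolding CycB_altdef[OF \<sigma>] CycB_altdef[OF comp] p_def[symmetric] q_def[symmetric] int
    using cond new by blast
  then show ?thesis by (simp only: \<tau>_def N_def)
qed

section \<open>Equidistribution\<close>

text \<open>The bijection is built recursively: split off the last letter with
  \<open>signed_transpose\<close>, apply the bijection for \<open>n\<close>, and append the same
  letter with \<open>signed_shift\<close>. The rules for \<open>CycB\<close> and
  \<open>LmapB\<close> agree, and \<open>RmilB_comp\<close> covers both factorizations.\<close>

lemma ex_CycB_to_LmapB:
  "\<exists>\<phi>. bij_betw \<phi> (signed_perms n) (signed_perms n) \<and>
    (\<forall>\<sigma>\<in>signed_perms n. LmapB n (\<phi> \<sigma>) = CycB n \<sigma> \<and> RmilB n (\<phi> \<sigma>) = RmilB n \<sigma>)"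
proof (induction n)
  case 0
  \<comment> \<open>For \<open>n = 0\<close> both \<open>LmapB\<close> and \<open>CycB\<close> are
    empty, so the identity serves.\<close>
  show ?case
    by (intro exI[of _ "\<lambda>\<sigma>. \<sigma>"]) (auto simp: LmapB_def CycB_def abs_cycles_def bij_betw_def)
next
  case (Suc n)
  then obtain \<phi> where \<phi>: "bij_betw \<phi> (signed_perms n) (signed_perms n)"
    and L: "\<And>\<sigma>. \<sigma> \<in> signed_perms n \<Longrightarrow> LmapB n (\<phi> \<sigma>) = CycB n \<sigma>"
    and R: "\<And>\<sigma>. \<sigma> \<in> signed_perms n \<Longrightarrow> RmilB n (\<phi> \<sigma>) = RmilB n \<sigma>"
    by blast
  let ?N = "int (Suc n)" and ?V = "signed_interval (Suc n)"
  let ?D = "signed_perms n \<times> ?V"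
  let ?F = "\<lambda>(\<sigma>, v). signed_transpose ?N v \<circ> \<sigma>" and ?G = "\<lambda>(\<sigma>, v). signed_shift ?N v \<circ> \<sigma>"
  have F: "bij_betw ?F ?D (signed_perms (Suc n))"
    by (rule bij_betw_signed_perms_Suc[OF signed_transpose_mem]) (simp_all add: signed_transpose_def)
  have G: "bij_betw ?G ?D (signed_perms (Suc n))"
    by (rule bij_betw_signed_perms_Suc[OF signed_shift_mem]) (simp_all add: signed_shift_def)
  have M: "bij_betw (map_prod \<phi> id) ?D ?D" by (rule bij_betw_map_prod[OF \<phi> bij_betw_id])
  let ?\<psi> = "?G \<circ> map_prod \<phi> id \<circ> inv_into ?D ?F"
  have "bij_betw ?\<psi> (signed_perms (Suc n)) (signed_perms (Suc n))"
    by (intro bij_betw_trans[OF bij_betw_inv_into[OF F]] bij_betw_trans[OF M] G)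
  moreover have "LmapB (Suc n) (?\<psi> \<pi>) = CycB (Suc n) \<pi> \<and> RmilB (Suc n) (?\<psi> \<pi>) = RmilB (Suc n) \<pi>"
    if \<pi>: "\<pi> \<in> signed_perms (Suc n)" for \<pi>
  proof -
    obtain \<sigma> v where \<sigma>: "\<sigma> \<in> signed_perms n" and v: "v \<in> ?V" and \<pi>_eq: "\<pi> = ?F (\<sigma>, v)"
      using \<pi> F unfolding bij_betw_def by blast
    have "inv_into ?D ?F \<pi> = (\<sigma>, v)"
      unfolding \<pi>_eq by (rule inv_into_f_f[OF bij_betw_imp_inj_on[OF F]]) (use \<sigma> v in blast)
    then have \<psi>: "?\<psi> \<pi> = signed_shift ?N v \<circ> \<phi> \<sigma>" by simp
    have \<phi>\<sigma>: "\<phi> \<sigma> \<in> signed_perms n" using \<phi> \<sigma> by (rule bij_betw_apply)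
    have "LmapB (Suc n) (signed_shift ?N v \<circ> \<phi> \<sigma>) = CycB (Suc n) (signed_transpose ?N v \<circ> \<sigma>)"
      unfolding LmapB_signed_shift[OF \<phi>\<sigma> v] CycB_signed_transpose[OF \<sigma> v] L[OF \<sigma>] ..
    moreover have "RmilB (Suc n) (signed_shift ?N v \<circ> \<phi> \<sigma>) = {u \<in> RmilB n \<sigma>. u < \<bar>v\<bar>} \<union> {u. u = v \<and> 0 < v}"
      unfolding R[OF \<sigma>, symmetric]
      by (rule RmilB_comp[OF \<phi>\<sigma> signed_shift_mem[OF v]])
        (use v in \<open>auto simp: signed_shift_def mem_signed_interval\<close>)
    moreover have "RmilB (Suc n) (signed_transpose ?N v \<circ> \<sigma>) = {u \<in> RmilB n \<sigma>. u < \<bar>v\<bar>} \<union> {u. u = v \<and> 0 < v}"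
      by (rule RmilB_comp[OF \<sigma> signed_transpose_mem[OF v]])
        (use v in \<open>auto simp: signed_transpose_def mem_signed_interval\<close>)
    ultimately show ?thesis unfolding \<psi> by (simp add: \<pi>_eq)
  qed
  ultimately show ?case by blast
qed

text \<open>The bijection carries the fibre of one pair over \<open>(X, Y)\<close> onto that of the
  other.\<close>

lemma joint_count_cong_bij:
  assumes "bij_betw \<phi> (signed_perms n) (signed_perms n)"
    and "\<And>\<sigma>. \<sigma> \<in> signed_perms n \<Longrightarrow> S' n (\<phi> \<sigma>) = S n \<sigma>"
    and "\<And>\<sigma>. \<sigma> \<in> signed_perms n \<Longrightarrow> T' n (\<phi> \<sigma>) = T n \<sigma>"
  shows "joint_count n S T X Y = joint_count n S' T' X Y"
  unfolding joint_count_def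
proof (rule bij_betw_same_card[of \<phi>])
  let ?A = "{\<sigma> \<in> signed_perms n. (S n \<sigma>, T n \<sigma>) = (X, Y)}"
    and ?B = "{\<sigma> \<in> signed_perms n. (S' n \<sigma>, T' n \<sigma>) = (X, Y)}"
  have "\<phi> ` ?A = ?B"
  proof (intro equalityI subsetI)
    fix \<pi> assume "\<pi> \<in> ?B"
    moreover from this obtain \<sigma> where "\<sigma> \<in> signed_perms n" "\<pi> = \<phi> \<sigma>"
      using assms(1) unfolding bij_betw_def by blast
    ultimately show "\<pi> \<in> \<phi> ` ?A" using assms(2,3) by simp
  qed (use assms bij_betw_apply in fastforce)
  then show "bij_betw \<phi> ?A ?B"
    by (intro bij_betw_subset[OF assms(1)]) auto
qed

lemma joint_count_swap: "joint_count n S T X Y = joint_count n T S Y X"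
  unfolding joint_count_def by (rule arg_cong[of _ _ card]) auto

lemma joint_count_CycB_RmilB: "joint_count n CycB RmilB X Y = joint_count n LmapB RmilB X Y"
  using ex_CycB_to_LmapB[of n] joint_count_cong_bij[of _ n LmapB CycB RmilB RmilB] by blast

lemma joint_count_inv:
  "joint_count n CycB RmilB X Y = joint_count n CycB LmapB X Y"
  "joint_count n RmilB LmapB X Y = joint_count n LmapB RmilB X Y"
  by (rule joint_count_cong_bij[OF bij_betw_inv_signed_perms]; simp add: CycB_inv LmapB_inv RmilB_inv)+

theorem theorem3p8:
  fixes n :: nat and X Y :: "int set"
  assumes "n \<ge> 1" and "X \<subseteq> interval n" and "Y \<subseteq> interval n"
  shows "joint_count n CycB RmilB X Y = joint_count n CycB LmapB X Y
    \<and> joint_count n CycB LmapB X Y = joint_count n RmilB LmapB X Y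
    \<and> joint_count n RmilB LmapB X Y = joint_count n LmapB RmilB X Y
    \<and> joint_count n LmapB RmilB X Y = joint_count n LmapB CycB X Y
    \<and> joint_count n LmapB CycB X Y = joint_count n RmilB CycB X Y"
proof -
  \<comment> \<open>Swapping leads to \<open>(CycB, LmapB)\<close> at \<open>(Y, X)\<close>, which
    agrees there with \<open>(CycB, RmilB)\<close> and then \<open>(LmapB, RmilB)\<close>. Swapping
    back gives \<open>(RmilB, LmapB)\<close> at \<open>(X, Y)\<close>, and inversion
    finishes.\<close>
  have LC: "joint_count n LmapB CycB X Y = joint_count n LmapB RmilB X Y"
    using joint_count_swap joint_count_inv joint_count_CycB_RmilB by metis
  have RC: "joint_count n RmilB CycB X Y = joint_count n LmapB CycB X Y"
    using joint_count_swap joint_count_inv(1) by metis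
  show ?thesis
    using LC RC joint_count_inv[of n X Y] joint_count_CycB_RmilB[of n X Y] by simp
qed

end
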